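(* Let $F(s)=\sum_{n\geqslant 1} f(n)n^{-s}$ be a nondegenerate ordinary Dirichlet series with $f(n)\geqslant 0$ for all $n$, which is convergent for $\Re(s)\geqslant s_0$ (where $s_0\in\mathbb{R}$). Then $H_n^{(r)}[F]>0$ for all integers $n\geqslant 1$ and all integers $r\geqslant s_0-2$, and there is a constant $c>0$ such that $$\log H_n^{(r)}[F]<-c\,n^2$$ for all sufficiently large integers $n$ and $r$ (that is, there exist $c>0$, $N_0$ and $R_0$ such that the inequality holds for all integers $n\geqslant N_0$ and $r\geqslant R_0$).
   Context: An ordinary Dirichlet series is a series $F(s)=\sum_{n\geqslant 1} f(n)n^{-s}$. It is called nondegenerate if infinitely many of the coefficients $f(n)$ are nonzero. For a real-valued function $h$ on integers, and integers $n\geqslant 1$ and $r$, the Hankel determinant of size $n$ starting at offset $r$ is $$H_n^{(r)}[h]=\det_{1\leqslant i,j\leqslant n}\big(h(i+j+r)\big),$$ so $H_n^{(r)}[F]=\det_{1\leqslant i,j\leqslant n}\big(F(i+j+r)\big)$. *)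

theory Defs
  imports "HOL-Analysis.Analysis" "Jordan_Normal_Form.Determinant"
begin

text \<open>Coefficient sequences are indexed by the positive integers; the value at 0 plays no role.
  Summation from 0 is therefore shifted by one. Convergence is convergence of the ordered partial
  sums.\<close>

definition dirichlet_term :: "(nat \<Rightarrow> real) \<Rightarrow> complex \<Rightarrow> nat \<Rightarrow> complex" where
  "dirichlet_term f s n = complex_of_real (f n) * of_nat n powr (- s)"

definition dirichlet_convergent :: "(nat \<Rightarrow> real) \<Rightarrow> complex \<Rightarrow> bool" where
  "dirichlet_convergent f s \<longleftrightarrow> summable (\<lambda>n. dirichlet_term f s (Suc n))"

definition dirichlet_series :: "(nat \<Rightarrow> real) \<Rightarrow> complex \<Rightarrow> complex" where
  "dirichlet_series f s = (\<Sum>n. dirichlet_term f s (Suc n))"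

definition nondegenerate :: "(nat \<Rightarrow> real) \<Rightarrow> bool" where
  "nondegenerate f \<longleftrightarrow> infinite {n. n \<ge> 1 \<and> f n \<noteq> 0}"

text \<open>Rows and columns of Jordan_Normal_Form matrices are numbered from 0, whence the shift
  of both indices. Theory qualifiers select these matrices rather than those of HOL-Analysis.\<close>

definition hankel_det :: "nat \<Rightarrow> int \<Rightarrow> (int \<Rightarrow> real) \<Rightarrow> real" where
  "hankel_det n r h =
     Determinant.det (Matrix.mat n n (\<lambda>(i, j). h (int (Suc i) + int (Suc j) + r)))"

text \<open>The restriction of the series to the integers. With real coefficients a convergent series
  has real sum at a real point, so taking the real part loses nothing.\<close>

definition dirichlet_at_int :: "(nat \<Rightarrow> real) \<Rightarrow> int \<Rightarrow> real" where
  "dirichlet_at_int f k = Re (dirichlet_series f (of_int k))"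

end

theory Submission
  imports Defs "HOL-Real_Asymp.Real_Asymp"
begin

text \<open>
  With \<open>x\<^sub>m = 1/m\<close> and \<open>w\<^sub>m = f(m) m powi -(r+2)\<close>, the entry in row \<open>i\<close> and column \<open>j\<close> (numbered
  from 0) of the Hankel matrix is \<open>F(i + j + r + 2) = \<Sum>m. w\<^sub>m * x\<^sub>m ^ (i + j)\<close>. So it is the moment
  matrix of a finite positive measure, the sum of point masses \<open>w\<^sub>m\<close> at the nodes \<open>x\<^sub>m\<close> of the
  unit interval.

  Positivity: the quadratic form of this matrix at a vector \<open>v\<close> is \<open>\<Sum>m. w\<^sub>m * p(x\<^sub>m)^2\<close>, where
  \<open>p\<close> is the polynomial with coefficients \<open>v\<close>. Nondegeneracy gives infinitely many nodes of
  positive mass, and a nonzero \<open>p\<close> cannot vanish at all of them. Hence the form is positive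
  definite and its determinant is positive (\<open>det_pos_if_positive_definite\<close>, \<open>moment_det_pos\<close>).

  Upper bound: replacing the monomials \<open>x ^ i\<close> by the monic polynomials \<open>(x - 1/2) ^ i\<close> is a
  unitriangular change of basis, so it does not change the determinant (\<open>moment_det_translate\<close>).
  The unit interval has radius \<open>1/2\<close> about its midpoint, so the new entries are at most
  \<open>C * 2 ^ -(i + j)\<close> in absolute value, where \<open>C\<close> is the total mass. Each of the \<open>n!\<close> terms of
  the Leibniz expansion is then at most \<open>C ^ n * 2 ^ -(n * (n - 1))\<close> (\<open>moment_det_le\<close>). The
  total mass decreases in \<open>r\<close>, so one \<open>C\<close> serves all large \<open>r\<close>; and \<open>ln (n!)\<close> and
  \<open>n * ln C\<close> are of smaller order than \<open>n ^ 2\<close>.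
\<close>

section \<open>Determinants of real matrices\<close>

text \<open>
  Positive definiteness is preserved along the segment from the identity to the matrix, so the
  determinant does not vanish there; being continuous and equal to 1 at the identity, it stays
  positive.
\<close>

lemma det_pos_if_positive_definite:
  fixes a :: "nat \<Rightarrow> nat \<Rightarrow> real"
  assumes pd: "\<And>v. \<exists>i<n. v i \<noteq> 0 \<Longrightarrow> (\<Sum>i<n. \<Sum>j<n. v i * v j * a i j) > 0"
  shows "Determinant.det (Matrix.mat n n (\<lambda>(i, j). a i j)) > 0"
proof -
  define b where "b t i j = t * a i j + (1 - t) * of_bool (i = j)" for t i j
  define d where "d t = Determinant.det (Matrix.mat n n (\<lambda>(i, j). b t i j))" for t
  have pd_b: "(\<Sum>i<n. \<Sum>j<n. v i * v j * b t i j) > 0"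
    if v: "\<exists>i<n. v i \<noteq> 0" and t: "0 \<le> t" "t \<le> 1" for v t
  proof -
    have "(\<Sum>i<n. \<Sum>j<n. v i * v j * b t i j)
        = t * (\<Sum>i<n. \<Sum>j<n. v i * v j * a i j) + (1 - t) * (\<Sum>i<n. (v i)\<^sup>2)"
    proof -
      have "v i * v j * b t i j
          = t * (v i * v j * a i j) + (1 - t) * (if j = i then (v i)\<^sup>2 else 0)" for i j
        by (simp add: b_def algebra_simps power2_eq_square)
      then show ?thesis
        by (simp add: sum.distrib flip: sum_distrib_left)
    qed
    moreover have "(\<Sum>i<n. (v i)\<^sup>2) > 0"
      using v by (auto intro!: sum_pos2)
    moreover note pd[OF v]
    ultimately show ?thesis
      using t by (cases "t = 0") (auto intro!: add_pos_nonneg)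
  qed
  have nonzero: "d t \<noteq> 0" if t: "0 \<le> t" "t \<le> 1" for t
  proof
    assume "d t = 0"
    let ?B = "Matrix.mat n n (\<lambda>(i, j). b t i j)"
    have "\<exists>u. u \<in> carrier_vec n \<and> u \<noteq> 0\<^sub>v n \<and> mult_mat_vec ?B u = 0\<^sub>v n"
      using \<open>d t = 0\<close> unfolding d_def by (subst (asm) det_0_iff_vec_prod_zero[of _ n]) auto
    then obtain u where u: "u \<in> carrier_vec n" "u \<noteq> 0\<^sub>v n" "mult_mat_vec ?B u = 0\<^sub>v n"
      by blast
    have row: "(\<Sum>j<n. b t i j * vec_index u j) = 0" if "i < n" for i
    proof -
      have "vec_index (mult_mat_vec ?B u) i = (\<Sum>j<n. b t i j * vec_index u j)"
        using that u(1) by (auto simp: scalar_prod_def atLeast0LessThan intro!: sum.cong)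
      then show ?thesis
        using u(3) that by simp
    qed
    have "\<exists>i<n. vec_index u i \<noteq> 0"
      using u(1,2) by auto
    then have "0 < (\<Sum>i<n. \<Sum>j<n. vec_index u i * vec_index u j * b t i j)"
      using t by (rule pd_b)
    also have "\<dots> = (\<Sum>i<n. vec_index u i * (\<Sum>j<n. b t i j * vec_index u j))"
      by (simp add: sum_distrib_left mult_ac)
    also have "\<dots> = 0"
      by (simp add: row)
    finally show False
      by simp
  qed
  have "continuous_on {0..1} d"
    unfolding d_def Determinant.det_def by (auto simp: b_def intro!: continuous_intros)
  moreover have "d 0 = 1"
  proof -
    have "Matrix.mat n n (\<lambda>(i, j). b 0 i j) = 1\<^sub>m n"
      by (auto simp: b_def)
    then show ?thesis
      by (simp add: d_def)
  qed
  ultimately have "d 1 > 0"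
    using IVT2'[of d 1 0 0] nonzero by force
  then show ?thesis
    by (simp add: d_def b_def)
qed

text \<open>
  In every term of the Leibniz expansion each index occurs once as a row and once as a column, so
  all terms carry the same power of \<open>\<rho>\<close>, namely twice \<open>0 + \<dots> + (n - 1)\<close>.
\<close>

lemma abs_det_le_weighted_entries:
  fixes a :: "nat \<Rightarrow> nat \<Rightarrow> real"
  assumes "\<And>i j. i < n \<Longrightarrow> j < n \<Longrightarrow> \<bar>a i j\<bar> \<le> C * \<rho> ^ (i + j)"
  shows "\<bar>Determinant.det (Matrix.mat n n (\<lambda>(i, j). a i j))\<bar>
    \<le> fact n * (C ^ n * \<rho> ^ (n * (n - 1)))"
proof -
  let ?P = "{p. p permutes {0..<n}}"
  have "\<bar>Determinant.det (Matrix.mat n n (\<lambda>(i, j). a i j))\<bar>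
      \<le> (\<Sum>p\<in>?P. \<bar>signof p * (\<Prod>i=0..<n. a i (p i))\<bar>)"
  proof -
    have "Determinant.det (Matrix.mat n n (\<lambda>(i, j). a i j))
        = (\<Sum>p\<in>?P. signof p * (\<Prod>i=0..<n. a i (p i)))"
      unfolding Determinant.det_def
      by (auto intro!: sum.cong prod.cong simp: permutes_nat_less)
    then show ?thesis
      by (simp only: sum_abs)
  qed
  also have "\<dots> \<le> (\<Sum>p\<in>?P. C ^ n * \<rho> ^ (n * (n - 1)))"
  proof (rule sum_mono)
    fix p assume "p \<in> ?P"
    then have p: "p permutes {0..<n}"
      by simp
    have "\<bar>signof p * (\<Prod>i=0..<n. a i (p i))\<bar> = (\<Prod>i=0..<n. \<bar>a i (p i)\<bar>)"
      by (simp add: abs_mult sign_def abs_prod)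
    also have "\<dots> \<le> (\<Prod>i=0..<n. C * \<rho> ^ (i + p i))"
      using p by (intro prod_mono conjI assms) (auto simp: permutes_nat_less permutes_in_image)
    also have "\<dots> = C ^ n * \<rho> ^ (\<Sum>i=0..<n. i + p i)"
      by (simp add: prod.distrib power_sum)
    also have "(\<Sum>i=0..<n. i + p i) = n * (n - 1)"
    proof -
      have "(\<Sum>i=0..<n. p i) = (\<Sum>i=0..<n. i)"
        using sum.permute[OF p, of "\<lambda>i. i"] by (simp add: o_def)
      moreover have "2 * (\<Sum>i=0..<n. i) = n * (n - 1)"
      proof (induction n)
        case (Suc n)
        then show ?case
          by (cases n) auto
      qed auto
      ultimately show ?thesis
        by (simp add: sum.distrib)
    qed
    finally show "\<bar>signof p * (\<Prod>i=0..<n. a i (p i))\<bar> \<le> C ^ n * \<rho> ^ (n * (n - 1))" .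
  qed
  also have "\<dots> = fact n * (C ^ n * \<rho> ^ (n * (n - 1)))"
    by (simp add: card_permutations[OF refl])
  finally show ?thesis .
qed

section \<open>Moment matrices of discrete measures on the unit interval\<close>

locale point_masses =
  fixes w x :: "nat \<Rightarrow> real"
  assumes mass_nonneg: "w m \<ge> 0"
    and summable_mass: "summable w"
    and node_bounds: "0 \<le> x m" "x m \<le> 1"
begin

definition moment :: "nat \<Rightarrow> real" where
  "moment k = (\<Sum>m. w m * x m ^ k)"

definition total_mass :: real where
  "total_mass = (\<Sum>m. w m)"

definition moment_det :: "nat \<Rightarrow> real" where
  "moment_det n = Determinant.det (Matrix.mat n n (\<lambda>(i, j). moment (i + j)))"

lemma moment_sums: "(\<lambda>m. w m * x m ^ k) sums moment k"
proof -
  have "summable (\<lambda>m. w m * x m ^ k)"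
    using mass_nonneg node_bounds
    by (intro summable_comparison_test'[OF summable_mass])
      (auto simp: abs_mult intro!: mult_left_le power_le_one)
  then show ?thesis
    unfolding moment_def by (rule summable_sums)
qed

text \<open>
  The moment matrix is the Gram matrix of the monomials: its bilinear form integrates the product
  of two polynomials. Equal coefficient vectors will give positive definiteness, different ones
  the effect of a change of polynomial basis.
\<close>

lemma moment_form_sums:
  "(\<lambda>m. w m * ((\<Sum>i<n. u i * x m ^ i) * (\<Sum>j<n. v j * x m ^ j)))
    sums (\<Sum>i<n. \<Sum>j<n. u i * v j * moment (i + j))"
proof -
  have "(\<lambda>m. \<Sum>i<n. \<Sum>j<n. u i * v j * (w m * x m ^ (i + j)))
      sums (\<Sum>i<n. \<Sum>j<n. u i * v j * moment (i + j))"
    by (intro sums_sum sums_mult moment_sums)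
  moreover have "(\<Sum>i<n. \<Sum>j<n. u i * v j * (w m * x m ^ (i + j)))
      = w m * ((\<Sum>i<n. u i * x m ^ i) * (\<Sum>j<n. v j * x m ^ j))" for m
    unfolding sum_product by (simp add: sum_distrib_left power_add mult_ac)
  ultimately show ?thesis
    by simp
qed

text \<open>
  The quadratic form integrates the square of a polynomial, and a nonzero polynomial has only
  finitely many roots, so it is nonzero at some node of positive mass.
\<close>

lemma moment_det_pos:
  assumes inf: "infinite (x ` {m. w m > 0})"
  shows "moment_det n > 0"
  unfolding moment_det_def
proof (rule det_pos_if_positive_definite)
  fix v :: "nat \<Rightarrow> real"
  assume "\<exists>i<n. v i \<noteq> 0"
  then obtain i where i: "i < n" "v i \<noteq> 0"
    by blast
  let ?p = "\<lambda>z. \<Sum>i<n. v i * z ^ i"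
  have "finite {z. ?p z = 0}"
    using polyfun_rootbound_finite[where c = v and n = "n - 1"] i
    by (cases n) (auto simp: lessThan_Suc_atMost less_Suc_eq_le)
  then obtain m where m: "w m > 0" "?p (x m) \<noteq> 0"
    using inf finite_subset[of "x ` {m. w m > 0}" "{z. ?p z = 0}"] by blast
  have sums: "(\<lambda>m. w m * (?p (x m) * ?p (x m))) sums (\<Sum>i<n. \<Sum>j<n. v i * v j * moment (i + j))"
    by (rule moment_form_sums)
  have "0 < (\<Sum>m. w m * (?p (x m) * ?p (x m)))"
  proof (rule suminf_pos2)
    show "0 < w m * (?p (x m) * ?p (x m))"
      using m by (auto simp: zero_less_mult_iff)
  qed (use mass_nonneg sums_summable[OF sums] in auto)
  then show "0 < (\<Sum>i<n. \<Sum>j<n. v i * v j * moment (i + j))"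
    using sums_unique[OF sums] by simp
qed

text \<open>
  The powers of \<open>x - c\<close> are monic, so their coefficient matrix with respect to the monomials is
  lower triangular with unit diagonal, and congruence by it preserves the determinant.
\<close>

lemma moment_det_translate:
  fixes c :: real
  shows "moment_det n
    = Determinant.det (Matrix.mat n n (\<lambda>(i, j). \<Sum>m. w m * (x m - c) ^ (i + j)))"
proof -
  define l where "l i j = real (i choose j) * (- c) ^ (i - j)" for i j
  let ?L = "Matrix.mat n n (\<lambda>(i, j). l i j)"
  let ?M = "Matrix.mat n n (\<lambda>(i, j). moment (i + j))"
  let ?T = "Matrix.mat n n (\<lambda>(i, j). \<Sum>m. w m * (x m - c) ^ (i + j))"
  have binom: "(\<Sum>k<n. l i k * z ^ k) = (z - c) ^ i" if "i < n" for i z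
  proof -
    have "(z - c) ^ i = (\<Sum>k\<le>i. l i k * z ^ k)"
      using binomial_ring[of z "- c" i] by (simp add: l_def mult_ac)
    also have "\<dots> = (\<Sum>k<n. l i k * z ^ k)"
      using that by (intro sum.mono_neutral_left) (auto simp: l_def not_le)
    finally show ?thesis
      by simp
  qed
  have "?L * ?M * transpose_mat ?L = ?T"
  proof (rule eq_matI)
    fix i j assume "i < dim_row ?T" "j < dim_col ?T"
    then have ij: "i < n" "j < n"
      by auto
    have "index_mat (?L * ?M * transpose_mat ?L) (i, j)
        = (\<Sum>b<n. (\<Sum>a<n. l i a * moment (a + b)) * l j b)"
      using ij by (auto simp: scalar_prod_def atLeast0LessThan intro!: sum.cong)
    also have "\<dots> = (\<Sum>a<n. \<Sum>b<n. l i a * l j b * moment (a + b))"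
      by (subst sum.swap) (simp add: sum_distrib_left sum_distrib_right mult_ac)
    also have "\<dots> = (\<Sum>m. w m * (x m - c) ^ (i + j))"
      using sums_unique[OF moment_form_sums[where n = n and u = "l i" and v = "l j"]] ij
      by (simp add: binom power_add)
    finally show "index_mat (?L * ?M * transpose_mat ?L) (i, j) = index_mat ?T (i, j)"
      using ij by simp
  qed auto
  moreover have "Determinant.det ?L = 1"
    by (subst det_lower_triangular[of n])
      (auto simp: l_def prod_list_diag_prod)
  moreover have "Determinant.det (?L * ?M * transpose_mat ?L)
      = Determinant.det ?L * Determinant.det ?M * Determinant.det ?L"
  proof -
    have L: "?L \<in> carrier_mat n n" and M: "?M \<in> carrier_mat n n"
      by simp_all
    show ?thesis
      using L by (simp only: det_mult[OF mult_carrier_mat[OF L M]] det_mult[OF L M]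
          transpose_carrier_mat det_transpose[OF L])
  qed
  ultimately show ?thesis
    by (simp add: moment_det_def)
qed

text \<open>
  The midpoint \<open>1/2\<close> is the best centre: it halves the radius of the interval, and this is what
  makes the bound decay like \<open>2 ^ -(n ^ 2)\<close>. About the centre 0 the entries need not decay.
\<close>

lemma moment_det_le:
  "moment_det n \<le> fact n * (total_mass ^ n * (1 / 2) ^ (n * (n - 1)))"
proof -
  have "\<bar>\<Sum>m. w m * (x m - 1 / 2) ^ k\<bar> \<le> total_mass * (1 / 2) ^ k" for k
  proof -
    have bound: "norm (w m * (x m - 1 / 2) ^ k) \<le> w m * (1 / 2) ^ k" for m
    proof -
      have "\<bar>x m - 1 / 2\<bar> ^ k \<le> (1 / 2) ^ k"
        using node_bounds[of m] by (intro power_mono) (auto simp: abs_if)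
      then show ?thesis
        using mass_nonneg[of m] by (auto simp: abs_mult power_abs intro!: mult_left_mono)
    qed
    have sm: "summable (\<lambda>m. w m * (1 / 2) ^ k)"
      using summable_mass by (rule summable_mult2)
    have "norm (\<Sum>m. w m * (x m - 1 / 2) ^ k) \<le> (\<Sum>m. w m * (1 / 2) ^ k)"
      using bound sm by (rule norm_suminf_le)
    then show ?thesis
      using suminf_mult2[OF summable_mass, of "(1 / 2) ^ k"] by (simp add: total_mass_def)
  qed
  then show ?thesis
    unfolding moment_det_translate[of n "1 / 2"]
    by (intro order_trans[OF abs_ge_self abs_det_le_weighted_entries])
qed

end

section \<open>Dirichlet series at integers as moments\<close>

definition dirichlet_mass :: "(nat \<Rightarrow> real) \<Rightarrow> int \<Rightarrow> nat \<Rightarrow> real" where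
  "dirichlet_mass f k m = f (Suc m) * real (Suc m) powi (- k)"

definition dirichlet_node :: "nat \<Rightarrow> real" where
  "dirichlet_node m = 1 / real (Suc m)"

lemma dirichlet_term_of_int:
  "dirichlet_term f (of_int k) (Suc m) = of_real (dirichlet_mass f k m)"
proof -
  have "(of_nat (Suc m) :: complex) powr (- of_int k) = of_nat (Suc m) powi (- k)"
    using complex_powr_of_int[of "of_nat (Suc m)" "- k"] by (simp del: of_nat_Suc)
  then show ?thesis
    by (simp add: dirichlet_term_def dirichlet_mass_def of_real_power_int del: of_nat_Suc)
qed

lemma dirichlet_at_int_eq:
  assumes "dirichlet_convergent f (of_int k)"
  shows "summable (dirichlet_mass f k)" "dirichlet_at_int f k = (\<Sum>m. dirichlet_mass f k m)"
proof -
  show summable: "summable (dirichlet_mass f k)"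
    using assms by (simp add: dirichlet_convergent_def dirichlet_term_of_int summable_complex_of_real)
  show "dirichlet_at_int f k = (\<Sum>m. dirichlet_mass f k m)"
    by (simp add: dirichlet_at_int_def dirichlet_series_def dirichlet_term_of_int
        flip: suminf_of_real[OF summable])
qed

lemma dirichlet_mass_add_nat:
  "dirichlet_mass f (k + int l) m = dirichlet_mass f k m * dirichlet_node m ^ l"
proof -
  have "real (Suc m) powi (- (k + int l)) = real (Suc m) powi (- k) * real (Suc m) powi (- int l)"
    by (subst power_int_add[symmetric]) (simp_all del: of_nat_Suc)
  also have "real (Suc m) powi (- int l) = dirichlet_node m ^ l"
    by (simp add: dirichlet_node_def power_int_minus power_divide divide_simps del: of_nat_Suc)
  finally show ?thesis
    by (simp add: dirichlet_mass_def)
qed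

lemma point_masses_dirichlet:
  assumes "\<And>n. n \<ge> 1 \<Longrightarrow> f n \<ge> 0" "dirichlet_convergent f (of_int k)"
  shows "point_masses (dirichlet_mass f k) dirichlet_node"
  using assms(1) dirichlet_at_int_eq(1)[OF assms(2)]
  by unfold_locales (auto simp: dirichlet_mass_def dirichlet_node_def)

text \<open>
  The shift from \<open>r\<close> to \<open>r + 2\<close> arises because the smallest argument of the Hankel matrix,
  in its top left corner, is \<open>1 + 1 + r\<close>.
\<close>

lemma hankel_det_eq_moment_det:
  assumes f: "\<And>n. n \<ge> 1 \<Longrightarrow> f n \<ge> 0"
    and conv: "\<And>k. k \<ge> r + 2 \<Longrightarrow> dirichlet_convergent f (of_int k)"
  shows "hankel_det n r (dirichlet_at_int f)
    = point_masses.moment_det (dirichlet_mass f (r + 2)) dirichlet_node n"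
proof -
  interpret point_masses "dirichlet_mass f (r + 2)" dirichlet_node
    using f conv[of "r + 2"] by (rule point_masses_dirichlet) auto
  have "dirichlet_at_int f (int (Suc i) + int (Suc j) + r) = moment (i + j)" for i j
  proof -
    have k: "int (Suc i) + int (Suc j) + r = r + 2 + int (i + j)"
      by simp
    show ?thesis
      unfolding k moment_def dirichlet_mass_add_nat[symmetric]
      by (intro dirichlet_at_int_eq(2) conv) simp
  qed
  then show ?thesis
    by (simp only: hankel_det_def moment_det_def)
qed

lemma infinite_dirichlet_support:
  assumes "nondegenerate f" "\<And>n. n \<ge> 1 \<Longrightarrow> f n \<ge> 0"
  shows "infinite (dirichlet_node ` {m. dirichlet_mass f k m > 0})"
proof -
  have pos: "dirichlet_mass f k m > 0 \<longleftrightarrow> f (Suc m) \<noteq> 0" for m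
    using assms(2)[of "Suc m"]
    by (auto simp: dirichlet_mass_def zero_less_mult_iff less_le simp del: of_nat_Suc)
  have "{n. n \<ge> 1 \<and> f n \<noteq> 0} = Suc ` {m. f (Suc m) \<noteq> 0}"
    by (force simp: image_iff dest: Suc_le_D)
  then have "infinite {m. dirichlet_mass f k m > 0}"
    using assms(1) by (auto simp: nondegenerate_def pos)
  moreover have "inj dirichlet_node"
    by (auto simp: inj_on_def dirichlet_node_def)
  ultimately show ?thesis
    by (metis finite_imageD inj_on_subset subset_UNIV)
qed

text \<open>
  The left-hand side is the logarithm of the determinant bound with \<open>n!\<close> replaced by \<open>n ^ n\<close>.
  Its leading term is \<open>- ln 2 * n ^ 2\<close>, and the constant \<open>1/2\<close> leaves room below
  \<open>2/3 \<le> ln 2\<close>.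
\<close>

lemma gaussian_decay_eventually:
  assumes "C > 0"
  shows "\<forall>\<^sub>F n in sequentially.
    real n * ln (real n) + real n * ln C - real (n * (n - 1)) * ln 2 < - (1 / 2) * (real n)\<^sup>2"
proof -
  have "\<forall>\<^sub>F n in sequentially. real n * ln (real n) + real n * ln C
      - real n * (real n - 1) * (2 / 3) < - (1 / 2) * (real n)\<^sup>2"
    by real_asymp
  with eventually_ge_at_top[of 1] show ?thesis
  proof eventually_elim
    case (elim n)
    have "real (n * (n - 1)) * (2 / 3) \<le> real (n * (n - 1)) * ln 2"
      using ln2_ge_two_thirds by (intro mult_left_mono) auto
    moreover have "real (n * (n - 1)) = real n * (real n - 1)"
      using elim by (simp add: of_nat_diff)
    ultimately show ?case
      using elim by linarith
  qed
qed

section \<open>Hankel determinants of Dirichlet series\<close>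

theorem theorem1p3:
  fixes f :: "nat \<Rightarrow> real" and s0 :: real
  assumes "nondegenerate f"
    and "\<And>n. n \<ge> 1 \<Longrightarrow> f n \<ge> 0"
    and "\<And>s :: complex. Re s \<ge> s0 \<Longrightarrow> dirichlet_convergent f s"
  shows "(\<forall>n\<ge>1. \<forall>r :: int. of_int r \<ge> s0 - 2 \<longrightarrow> hankel_det n r (dirichlet_at_int f) > 0) \<and>
    (\<exists>c :: real. c > 0 \<and> (\<exists>(N0 :: nat) (R0 :: int). \<forall>n\<ge>N0. \<forall>r\<ge>R0.
        ln (hankel_det n r (dirichlet_at_int f)) < - c * (real n)\<^sup>2))"
proof -
  let ?H = "\<lambda>n r. hankel_det n r (dirichlet_at_int f)"
  let ?w = "\<lambda>r. dirichlet_mass f (r + 2)"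
  have conv: "dirichlet_convergent f (of_int k)" if "of_int r \<ge> s0 - 2" "k \<ge> r + 2" for k r :: int
    using that by (intro assms(3)) simp
  have pm: "point_masses (?w r) dirichlet_node" if "of_int r \<ge> s0 - 2" for r
    using point_masses_dirichlet assms(2) conv[OF that] by blast
  have H_eq: "?H n r = point_masses.moment_det (?w r) dirichlet_node n"
    if "of_int r \<ge> s0 - 2" for n r
    using hankel_det_eq_moment_det assms(2) conv[OF that] by blast
  have pos: "?H n r > 0" if "of_int r \<ge> s0 - 2" for n r
    unfolding H_eq[OF that]
    by (intro point_masses.moment_det_pos pm that infinite_dirichlet_support assms(1,2))
  define R0 where "R0 = \<lceil>s0\<rceil> - 2"
  have R0: "of_int r \<ge> s0 - 2" if "r \<ge> R0" for r
    using that unfolding R0_def by linarith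
  \<comment> \<open>Adding 1 to the total mass at the smallest offset makes \<open>ln C\<close> meaningful at no cost.\<close>
  define C where "C = 1 + (\<Sum>m. ?w R0 m)"
  have mass_nonneg: "?w r m \<ge> 0" for r m
    using assms(2)[of "Suc m"] by (simp add: dirichlet_mass_def)
  have summable: "summable (?w r)" if "r \<ge> R0" for r
    using pm[OF R0[OF that]] by (rule point_masses.summable_mass)
  have "C > 0"
    using suminf_nonneg[OF summable mass_nonneg, of R0] by (simp add: C_def)
  have H_le: "?H n r \<le> fact n * (C ^ n * (1 / 2) ^ (n * (n - 1)))" if r: "r \<ge> R0" for n r
  proof -
    interpret point_masses "?w r" dirichlet_node
      using pm R0 r by blast
    have "?w r m \<le> ?w R0 m" for m
      unfolding dirichlet_mass_def using r assms(2)[of "Suc m"]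
      by (intro mult_left_mono power_int_increasing) auto
    then have "total_mass \<le> C"
      unfolding total_mass_def C_def using suminf_le[OF _ summable summable, of r R0] r
      by fastforce
    moreover have "total_mass \<ge> 0"
      unfolding total_mass_def by (intro suminf_nonneg summable r mass_nonneg)
    ultimately have "fact n * (total_mass ^ n * (1 / 2) ^ (n * (n - 1)))
        \<le> fact n * (C ^ n * (1 / 2) ^ (n * (n - 1)))"
      by (intro mult_left_mono mult_right_mono power_mono) auto
    with moment_det_le[of n] show ?thesis
      unfolding H_eq[OF R0[OF r]] by (rule order_trans)
  qed
  from gaussian_decay_eventually[OF \<open>C > 0\<close>] obtain N where N: "\<And>n. n \<ge> N \<Longrightarrow>
      real n * ln (real n) + real n * ln C - real (n * (n - 1)) * ln 2 < - (1 / 2) * (real n)\<^sup>2"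
    by (auto simp: eventually_sequentially)
  have "ln (?H n r) < - (1 / 2) * (real n)\<^sup>2" if n: "n \<ge> max 1 N" and r: "r \<ge> R0" for n r
  proof -
    have "?H n r \<le> fact n * (C ^ n * (1 / 2) ^ (n * (n - 1)))"
      using r by (rule H_le)
    also have "\<dots> \<le> real n ^ n * (C ^ n * (1 / 2) ^ (n * (n - 1)))"
      using \<open>C > 0\<close> fact_le_power[of n, where 'a = real] by (intro mult_right_mono) auto
    finally have "ln (?H n r) \<le> ln (real n ^ n * (C ^ n * (1 / 2) ^ (n * (n - 1))))"
      using pos[OF R0[OF r]] by (simp add: ln_mono)
    also have "\<dots> = real n * ln (real n) + real n * ln C - real (n * (n - 1)) * ln 2"
      using \<open>C > 0\<close> n by (simp add: ln_mult ln_realpow ln_div del: of_nat_mult)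
    also have "\<dots> < - (1 / 2) * (real n)\<^sup>2"
      using n by (intro N) simp
    finally show ?thesis .
  qed
  then have "\<exists>c>0. \<exists>N0 R0. \<forall>n\<ge>N0. \<forall>r\<ge>R0. ln (?H n r) < - c * (real n)\<^sup>2"
    by (intro exI[of _ "1 / 2"] conjI exI[of _ "max 1 N"] exI[of _ R0]) auto
  with pos show ?thesis
    by blast
qed

end
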